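(* Let $u$ be a positive integer, let $i\ge 2$ be an integer, and let $k$ be an odd integer with $3\le k\le 2i-1$. Let $\mathfrak q$ be the largest integer not exceeding $P_{2i+1}(u)/P_k(u)$ with $\mathfrak q\equiv 1\pmod u$. Then for every integer $p$ with $0\le p\le(\mathfrak q-1)/u$, \begin{align*} &n_p\bigl(P_{2i+1}(u),P_{2i+3}(u),P_{2i+k+1}(u)\bigr)\\ &=-\frac{p^2}{2}\,uP_k(u)P_{k-2}(u)+\frac{p}{2}P_k(u)\bigl(2P_{2i+3}(u)-uP_{k-2}(u)\bigr)\\ &\quad+\frac{1}{2u}\biggl(\bigl(P_{2i+1}(u)-u\bigr)\bigl(P_{2i+3}(u)-u\bigr)+u(u-1)\bigl(P_{2i+k+1}(u)-1\bigr)\\ &\qquad-\mathfrak q P_{k-2}(u)\bigl(2P_{2i+1}(u)-(\mathfrak q+u)P_k(u)\bigr)\biggr). \end{align*}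
   Context: For a fixed positive integer $u$, the Pell-type numbers $P_n(u)$ are defined by $P_0(u)=0$, $P_1(u)=1$ and $P_n(u)=uP_{n-1}(u)+P_{n-2}(u)$ for $n\ge 2$. Let $A=\{a_1,\dots,a_\kappa\}$ be a set of positive integers with $\gcd(a_1,\dots,a_\kappa)=1$ and let $p$ be a nonnegative integer. $S_p(A)$ is the set of integers $n$ for which there are more than $p$ tuples $(x_1,\dots,x_\kappa)$ of nonnegative integers with $n=x_1a_1+\cdots+x_\kappa a_\kappa$. The set $\mathbb{N}_0\setminus S_p(A)$, with $\mathbb{N}_0=\{0,1,2,\dots\}$, is finite; the $p$-genus $n_p(A)=n_p(a_1,\dots,a_\kappa)$ is its cardinality. *)

theory Defs
  imports Complex_Main "HOL-Library.FuncSet" "HOL-Number_Theory.Cong"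
begin

fun pell :: "nat \<Rightarrow> nat \<Rightarrow> nat" where
  "pell u 0 = 0"
| "pell u (Suc 0) = 1"
| "pell u (Suc (Suc n)) = u * pell u (Suc n) + pell u n"

text \<open>A tuple of nonnegative integers indexed by the elements of \<open>A\<close> is an extensional
  function on \<open>A\<close>, so that distinct tuples are distinct functions.\<close>

definition representations :: "nat set \<Rightarrow> nat \<Rightarrow> (nat \<Rightarrow> nat) set" where
  "representations A n = {x \<in> A \<rightarrow>\<^sub>E UNIV. n = (\<Sum>a\<in>A. x a * a)}"

text \<open>For a finite \<open>A\<close> of positive integers every \<open>representations A n\<close> is finite, so
  \<open>card\<close> is the true number of representations; negative integers have none, so it suffices
  to consider natural numbers.\<close>

definition S_set :: "nat \<Rightarrow> nat set \<Rightarrow> nat set" where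
  "S_set p A = {n. p < card (representations A n)}"

text \<open>For a finite \<open>A\<close> of positive integers with \<open>Gcd A = 1\<close> the complement of
  \<open>S_set p A\<close> is finite, so \<open>card\<close> is its true cardinality.\<close>

definition p_genus :: "nat \<Rightarrow> nat set \<Rightarrow> nat" where
  "p_genus p A = card (UNIV - S_set p A)"

end

theory Submission
  imports Defs
begin

text \<open>
  Write \<open>a\<close>, \<open>b\<close>, \<open>c\<close> for the three generators, \<open>r = P_k\<close> and \<open>s = P_{k-2}\<close>, so that
  \<open>r b = u c + s a\<close>. Representations of \<open>n\<close> are pairs \<open>(y, z)\<close> of naturals with
  \<open>b y + c z \<le> n\<close> and \<open>b y + c z \<equiv> n (mod a)\<close>. The pairs of integers with
  \<open>b y + c z \<equiv> 0 (mod a)\<close> form a lattice with basis \<open>(r, -u)\<close>, \<open>(d, q)\<close>, where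
  \<open>a = u d + r q\<close>; these two vectors change \<open>b y + c z\<close> by \<open>s a\<close> and \<open>w a\<close> with
  \<open>u w + q s = b\<close>, and \<open>w\<close> is large compared to \<open>s\<close>. The L-shaped region
  \<open>[0, r) \<times> [0, q) \<union> [0, d) \<times> [q, q + u)\<close> contains the pair of least value of each residue
  class. The following pairs of the class are reached by adding \<open>(r, -u)\<close> as long as the second
  coordinate permits, and then by restarting from the translate by \<open>(d, q)\<close> (or by
  \<open>(d - r, q + u)\<close>, if that is nonnegative). For \<open>p \<le> (q - 1) / u\<close> these two chains contain
  the \<open>p + 1\<close> pairs of smallest value, and summing the value of the last of them over the
  L-shaped region gives the \<open>p\<close>-genus.
\<close>

section \<open>Representations modulo the smallest generator\<close>

text \<open>The Pell-type numbers enter the counting only through these relations.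
  \<open>bound\<close> says that, in units of \<open>a\<close>, one step by \<open>(d, q)\<close>
  costs at least as much as \<open>t + 1\<close> steps by \<open>(r, -u)\<close>; this orders the
  pairs of a class up to position \<open>t\<close>.\<close>

locale two_generator_lattice =
  fixes a b c r s u t d w :: nat
  assumes a_eq: "a = u * d + r * (1 + u * t)"
    and d_less: "d < r"
    and rel: "r * b = u * c + s * a"
    and b_eq: "b = u * w + (1 + u * t) * s"
    and bound: "(t + 1) * s \<le> w"
    and u_pos: "0 < u" and s_pos: "0 < s"
    and coprime_ab: "coprime a b" and coprime_au: "coprime a u"
begin

definition q :: nat where "q = 1 + u * t"

fun val :: "nat \<times> nat \<Rightarrow> nat" where
  "val (y, z) = b * y + c * z"

definition L :: "(nat \<times> nat) set" where
  "L = {..<r} \<times> {..<q} \<union> {..<d} \<times> {q..<q + u}"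

definition pts :: "nat \<Rightarrow> (nat \<times> nat) set" where
  "pts n = {x. val x \<le> n \<and> [val x = n] (mod a)}"

text \<open>\<open>pt x j\<close> is the pair in position \<open>j\<close>, counted from \<open>0\<close>, of the residue class of
  \<open>x \<in> L\<close>, and its value exceeds that of \<open>x\<close> by \<open>a * lev x j\<close>; both are meaningful
  only for \<open>j \<le> t\<close>.\<close>

fun lev :: "nat \<times> nat \<Rightarrow> nat \<Rightarrow> nat" where
  "lev (y, z) j = (if j \<le> z div u then j * s
     else w + (j - z div u - 1) * s - (if r \<le> y + d then s else 0))"

fun pt :: "nat \<times> nat \<Rightarrow> nat \<Rightarrow> nat \<times> nat" where
  "pt (y, z) j = (if j \<le> z div u then (y + j * r, z - j * u)
     else if r \<le> y + d then (y + d - r + (j - z div u - 1) * r, z + q + u - (j - z div u - 1) * u)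
     else (y + d + (j - z div u - 1) * r, z + q - (j - z div u - 1) * u))"

section \<open>The lattice of pairs with value divisible by \<open>a\<close>\<close>

lemma r_pos: "0 < r"
  using d_less by simp

lemma a_pos: "0 < a"
  using r_pos by (simp add: a_eq)

lemma s_le_w: "s \<le> w"
  using bound by simp

lemma a_int: "int a = int u * int d + int r * int q"
  using a_eq by (metis q_def of_nat_add of_nat_mult)

lemma b_int: "int b = int u * int w + int q * int s"
  using b_eq by (metis q_def of_nat_add of_nat_mult)

lemma rel_int: "int r * int b = int u * int c + int s * int a"
  using rel by (metis of_nat_add of_nat_mult)

text \<open>Multiplied by \<open>u\<close>, the left side becomes
  \<open>b (a - r q) + q (r b - s a) = a (b - q s) = a u w\<close>.\<close>

lemma val_dq: "int b * int d + int c * int q = int a * int w"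
proof -
  have "int u * (int b * int d + int c * int q) = int u * (int a * int w)"
    using rel_int a_int b_int by algebra
  then show ?thesis using u_pos by simp
qed

text \<open>Cramer's rule: \<open>(d, q)\<close> and \<open>(r, -u)\<close> have determinant
  \<open>-a\<close>, so the coordinates of \<open>(dy, dz)\<close> are
  \<open>(u dy + r dz) / a\<close> and \<open>(q dy - d dz) / a\<close>. The first numerator is
  divisible by \<open>a\<close> after multiplication by \<open>b\<close>, the second after
  multiplication by \<open>u\<close>, and both factors are coprime to \<open>a\<close>.\<close>

lemma lattice:
  assumes "[val (Y, Z) = val (y, z)] (mod a)"
  obtains m j :: int where "int Y = int y + m * int d + j * int r"
    and "int Z = int z + m * int q - j * int u"
proof -
  define dy dz where "dy = int Y - int y" and "dz = int Z - int z"
  have "[int (val (Y, Z)) = int (val (y, z))] (mod int a)"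
    using assms by (simp only: cong_int_iff)
  then have "int a dvd int (val (Y, Z)) - int (val (y, z))"
    by (simp add: cong_iff_dvd_diff)
  then obtain e where "int (val (Y, Z)) - int (val (y, z)) = int a * e" by (elim dvdE)
  then have e: "int b * dy + int c * dz = int a * e"
    by (simp add: dy_def dz_def algebra_simps)
  have "int b * (int u * dy + int r * dz) = int a * (int u * e + int s * dz)"
    using rel_int e by algebra
  then have "int a dvd int b * (int u * dy + int r * dz)" by simp
  moreover have "coprime (int a) (int b)" using coprime_ab by simp
  ultimately have "int a dvd int u * dy + int r * dz"
    by (simp add: coprime_dvd_mult_right_iff)
  then obtain m where m: "int u * dy + int r * dz = int a * m" by (elim dvdE)
  have "int u * (int q * dy - int d * dz) = int a * (int q * m - dz)"
    using m a_int by algebra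
  then have "int a dvd int u * (int q * dy - int d * dz)" by simp
  moreover have "coprime (int a) (int u)" using coprime_au by simp
  ultimately have "int a dvd int q * dy - int d * dz"
    by (simp add: coprime_dvd_mult_right_iff)
  then obtain j where j: "int q * dy - int d * dz = int a * j" by (elim dvdE)
  have "int a * dy = int a * (m * int d + j * int r)" using m j a_int by algebra
  then have A: "dy = m * int d + j * int r" using a_pos by simp
  have "int a * dz = int a * (m * int q - j * int u)" using m j a_int by algebra
  then have B: "dz = m * int q - j * int u" using a_pos by simp
  show thesis
  proof (rule that)
    show "int Y = int y + m * int d + j * int r" using A dy_def by simp
    show "int Z = int z + m * int q - j * int u" using B dz_def by simp
  qed
qed

lemma val_shift:
  assumes "int Y = int y + m * int d + j * int r"
    and "int Z = int z + m * int q - j * int u"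
  shows "int (val (Y, Z)) = int (val (y, z)) + int a * (m * int w + j * int s)"
proof -
  have "int b * int Y + int c * int Z
      = int b * int y + int c * int z + int a * (m * int w + j * int s)"
    using assms rel_int val_dq by algebra
  then show ?thesis by simp
qed

lemma cong_shift:
  assumes "int Y = int y + m * int d + j * int r"
    and "int Z = int z + m * int q - j * int u"
  shows "[val (Y, Z) = val (y, z)] (mod a)"
proof -
  have "[int (val (Y, Z)) = int (val (y, z))] (mod int a)"
    unfolding val_shift[OF assms] by (simp add: cong_iff_dvd_diff)
  then show ?thesis by (simp only: cong_int_iff)
qed

section \<open>The L-shaped region as a complete residue system\<close>

text \<open>With \<open>m < 0\<close>, a nonnegative second coordinate forces \<open>j < 0\<close>
  in the first rectangle and \<open>j \<le> 0\<close> in the second, and then the first coordinate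
  is negative. With \<open>m \<ge> 0\<close>, \<open>d < r\<close> and \<open>y < r\<close> give
  \<open>0 < (1 + m + j) r\<close>. As \<open>m w + j s \<ge> m (w - s) \<ge> 0\<close>, points of
  \<open>L\<close> have the least value in their class.\<close>

lemma shift_nonneg:
  assumes L: "(y, z) \<in> L"
    and Y: "int Y = int y + m * int d + j * int r"
    and Z: "int Z = int z + m * int q - j * int u"
  shows "0 \<le> m" and "- m \<le> j"
proof -
  have yr: "y < r" using L d_less by (auto simp: L_def)
  show m: "0 \<le> m"
  proof (rule ccontr)
    assume "\<not> 0 \<le> m"
    then have m: "m \<le> -1" by simp
    have mq: "m * int q \<le> - int q" using mult_right_mono[OF m, of "int q"] by simp
    have md: "m * int d \<le> - int d" using mult_right_mono[OF m, of "int d"] by simp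
    consider "z < q" | "y < d" "z < q + u" using L by (auto simp: L_def)
    then show False
    proof cases
      case 1
      have "j * int u < 0" using 1 mq Z by linarith
      then have "j \<le> -1" using u_pos by (simp add: mult_less_0_iff)
      from mult_right_mono[OF this, of "int r"] have "j * int r \<le> - int r" by simp
      then show False using Y md yr by linarith
    next
      case 2
      have "j * int u < 1 * int u" using 2 mq Z by linarith
      then have "j < 1" using u_pos by (simp only: mult_less_cancel_right)
      then have "j * int r \<le> 0" by (simp add: mult_nonpos_nonneg)
      then show False using Y md 2 by linarith
    qed
  qed
  have "m * int d \<le> m * int r" using d_less m by (simp add: mult_left_mono)
  then have "0 < (1 + m + j) * int r" using Y yr by (simp add: algebra_simps)
  then have "0 < 1 + m + j" using r_pos by (simp add: zero_less_mult_iff)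
  then show "- m \<le> j" by simp
qed

text \<open>\<open>shift_nonneg\<close> applies to the shift between two congruent points of
  \<open>L\<close> and to its inverse, so both coefficients vanish.\<close>

lemma inj_on_L: "inj_on (\<lambda>x. val x mod a) L"
proof (rule inj_onI)
  fix x x' assume *: "x \<in> L" "x' \<in> L" "val x mod a = val x' mod a"
  obtain y z where x: "x = (y, z)" by (cases x)
  obtain Y Z where x': "x' = (Y, Z)" by (cases x')
  have "[val (Y, Z) = val (y, z)] (mod a)" using * x x' by (simp add: cong_def)
  then obtain m j where mj: "int Y = int y + m * int d + j * int r"
    "int Z = int z + m * int q - j * int u" by (rule lattice)
  have "0 \<le> m" "- m \<le> j" using shift_nonneg[OF _ mj] * x by auto
  moreover have "int y = int Y + (- m) * int d + (- j) * int r"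
    "int z = int Z + (- m) * int q - (- j) * int u" using mj by simp_all
  then have "0 \<le> - m" "- (- m) \<le> - j" using shift_nonneg[of Y Z y "- m" "- j" z] * x' by auto
  ultimately have "m = 0" "j = 0" by simp_all
  then show "x = x'" using mj x x' by simp
qed

lemma finite_L: "finite L"
  by (simp add: L_def)

lemma sum_L: "sum f L = (\<Sum>y<r. \<Sum>z<q. f (y, z)) + (\<Sum>y<d. \<Sum>z=q..<q + u. f (y, z))"
  unfolding L_def
  by (subst sum.union_disjoint) (auto simp: sum.cartesian_product simp del: sum.lessThan_Suc)

lemma card_L: "card L = a"
proof -
  have "card L = (\<Sum>x\<in>L. 1)" by simp
  also have "\<dots> = a" unfolding sum_L by (simp add: a_eq q_def algebra_simps)
  finally show ?thesis .
qed

text \<open>The rectangles contain \<open>r q + u d = a\<close> points, with distinct residues, so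
  every residue occurs.\<close>

lemma image_L: "(\<lambda>x. val x mod a) ` L = {..<a}"
proof (rule card_subset_eq)
  show "(\<lambda>x. val x mod a) ` L \<subseteq> {..<a}" using a_pos by auto
  show "card ((\<lambda>x. val x mod a) ` L) = card {..<a}"
    using card_image[OF inj_on_L] card_L by simp
qed simp

section \<open>The two chains of smallest pairs in a residue class\<close>

lemma pt_shift:
  assumes "j \<le> t" and "pt (y, z) j = (Y, Z)"
  obtains m i where "int Y = int y + m * int d + i * int r"
    and "int Z = int z + m * int q - i * int u"
    and "int (lev (y, z) j) = m * int w + i * int s"
proof -
  \<comment> \<open>\<open>z div u\<close> is the number of steps by \<open>(r, -u)\<close> that the
    second coordinate permits. Case 2 restarts at the translate by \<open>(d - r, q + u)\<close>,
    one step before the translate by \<open>(d, q)\<close>; hence its level is lower by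
    \<open>s\<close>.\<close>
  consider (1) "j \<le> z div u" | (2) "z div u < j" "r \<le> y + d" | (3) "z div u < j" "y + d < r"
    by linarith
  then show thesis
  proof cases
    case 1
    then have "j * u \<le> z" by (metis div_times_less_eq_dividend le_trans mult_le_mono1)
    then show thesis using that[of 0 "int j"] assms 1 by (auto simp: of_nat_diff)
  next
    case 2
    define i where "i = j - z div u - 1"
    \<comment> \<open>Here \<open>j \<le> t\<close> matters: it gives \<open>i * u < q\<close>, so
      the natural subtraction in \<open>pt\<close> does not truncate.\<close>
    have "i * u \<le> t * u" using assms 2 by (intro mult_le_mono1) (simp add: i_def)
    then have "i * u \<le> z + q + u" unfolding q_def by (metis add.assoc add.commute mult.commute trans_le_add1)
    moreover have "Y = y + d - r + i * r" "Z = z + q + u - i * u"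
      "lev (y, z) j = w + i * s - s"
      using assms(2) 2 by (simp_all add: i_def)
    ultimately show thesis using that[of 1 "int i - 1"] 2 s_le_w
      by (simp add: of_nat_diff left_diff_distrib)
  next
    case 3
    define i where "i = j - z div u - 1"
    have "i * u \<le> t * u" using assms 3 by (intro mult_le_mono1) (simp add: i_def)
    then have "i * u \<le> z + q" unfolding q_def by (metis add.assoc add.commute mult.commute trans_le_add1)
    moreover have "Y = y + d + i * r" "Z = z + q - i * u" "lev (y, z) j = w + i * s"
      using assms(2) 3 by (simp_all add: i_def)
    ultimately show thesis using that[of 1 "int i"] by (simp add: of_nat_diff)
  qed
qed

lemma val_pt:
  assumes "j \<le> t"
  shows "val (pt x j) = val x + a * lev x j" and "[val (pt x j) = val x] (mod a)"
proof -
  obtain y z where x: "x = (y, z)" by (cases x)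
  obtain Y Z where X: "pt (y, z) j = (Y, Z)" by (cases "pt (y, z) j")
  from pt_shift[OF assms X] obtain m i where *: "int Y = int y + m * int d + i * int r"
    "int Z = int z + m * int q - i * int u" "int (lev (y, z) j) = m * int w + i * int s" .
  have "int (val (pt x j)) = int (val x + a * lev x j)"
    using val_shift[OF *(1,2)] *(3) X x by (simp only: of_nat_add of_nat_mult)
  then show "val (pt x j) = val x + a * lev x j" by (simp only: of_nat_eq_iff)
  then show "[val (pt x j) = val x] (mod a)" by (simp add: cong_def)
qed

lemma lev_less:
  assumes "i < j" and "j \<le> t"
  shows "lev x i < lev x j"
proof -
  obtain y z where x: "x = (y, z)" by (cases x)
  define f where "f = z div u"
  consider (1) "j \<le> f" | (2) "i \<le> f" "f < j" | (3) "f < i" by linarith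
  then show ?thesis
  proof cases
    case 1
    then show ?thesis using assms s_pos by (simp add: x f_def)
  next
    case 2
    \<comment> \<open>At the change of chains, \<open>f < j \<le> t\<close> lets
      \<open>bound\<close> separate the last level \<open>f * s\<close> of the first chain from the
      lowest possible start \<open>w - s\<close> of the second.\<close>
    have "(f + 2) * s \<le> (t + 1) * s" using 2 assms by (intro mult_right_mono) auto
    then have w: "(f + 2) * s \<le> w" using bound by linarith
    have "i * s \<le> f * s" using 2 by simp
    moreover have "(f + 2) * s = f * s + 2 * s" by (simp add: algebra_simps)
    ultimately have "i * s < w - s" using w s_pos by linarith
    then show ?thesis using 2 by (auto simp: x f_def[symmetric])
  next
    case 3
    then have "(i - f - 1) * s < (j - f - 1) * s" using assms s_pos by simp
    then have "w + (i - f - 1) * s < w + (j - f - 1) * s" by (rule add_strict_left_mono)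
    moreover from this have "w + (i - f - 1) * s - s < w + (j - f - 1) * s - s"
      using s_le_w by (intro diff_less_mono) auto
    ultimately show ?thesis using 3 assms by (simp add: x f_def[symmetric])
  qed
qed

lemma inj_on_pt: "inj_on (pt x) {..t}"
proof (rule inj_onI)
  fix i j assume *: "i \<in> {..t}" "j \<in> {..t}" "pt x i = pt x j"
  then have "val x + a * lev x i = val x + a * lev x j"
    using val_pt(1)[of i x] val_pt(1)[of j x] by (simp only: atMost_iff)
  then have "a * lev x i = a * lev x j" by (simp only: add_left_cancel)
  then have "lev x i = lev x j" using a_pos by (simp only: mult_cancel1) simp
  then show "i = j" using lev_less[of i j x] lev_less[of j i x] *
    by (cases i j rule: linorder_cases) auto
qed

text \<open>The coefficient \<open>m\<close> of \<open>(d, q)\<close> decides: \<open>m = 0\<close>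
  is the first chain, \<open>m = 1\<close> the second, and \<open>m \<ge> 2\<close> costs too
  much.\<close>

lemma pts_below:
  assumes p: "p \<le> t" and L: "x \<in> L" and X: "[val X = val x] (mod a)"
    and less: "val X < val x + a * lev x p"
  shows "X \<in> pt x ` {..<p}"
proof -
  obtain y z where x: "x = (y, z)" by (cases x)
  obtain Y Z where XX: "X = (Y, Z)" by (cases X)
  obtain m j where mj: "int Y = int y + m * int d + j * int r"
    "int Z = int z + m * int q - j * int u"
    using X unfolding x XX by (rule lattice)
  have m: "0 \<le> m" and j: "- m \<le> j" using shift_nonneg[OF _ mj] L x by auto
  have "int (val X) < int (val x) + int a * int (lev x p)"
    using less by (metis of_nat_add of_nat_less_iff of_nat_mult)
  then have "int a * (m * int w + j * int s) < int a * int (lev x p)"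
    using val_shift[OF mj] x XX by simp
  then have lt: "m * int w + j * int s < int (lev x p)" using a_pos by simp
  define f where "f = z div u"
  have "(int t + 1) * int s \<le> int w"
    using bound by (metis of_nat_1 of_nat_add of_nat_le_iff of_nat_mult)
  then have bd: "int t * int s + int s \<le> int w" by (simp add: algebra_simps)
  have ps: "int p * int s \<le> int t * int s" using p by (intro mult_right_mono) auto
  have sw: "int s \<le> int w" using s_le_w by simp
  consider (0) "m = 0" | (1) "m = 1" | (2) "2 \<le> m" using m by linarith
  then show ?thesis
  proof cases
    case 0
    then have j0: "0 \<le> j" using j by simp
    have "j * int u \<le> int z" using mj(2) 0 by simp
    then have "nat j * u \<le> z" using j0 by (metis int_nat_eq of_nat_le_iff of_nat_mult)
    then have jf: "nat j \<le> f" using u_pos by (simp add: f_def less_eq_div_iff_mult_less_eq)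
    have jp: "nat j < p"
    proof (cases "p \<le> f")
      case True
      then have "j * int s < int p * int s" using lt 0 by (simp add: x f_def)
      then show ?thesis using s_pos j0 by (simp add: mult_less_cancel_right)
    qed (use jf in simp)
    have "Y = y + nat j * r" using mj(1) 0 j0 by (metis (no_types, lifting) add.right_neutral mult_zero_left
        nat_0_le of_nat_add of_nat_eq_iff of_nat_mult)
    moreover have "int Z = int (z - nat j * u)"
      using mj(2) 0 j0 \<open>nat j * u \<le> z\<close> by (simp add: of_nat_diff)
    ultimately have "X = pt x (nat j)" using jf by (simp add: x XX f_def)
    then show ?thesis using jp by auto
  next
    case 1
    have js: "- int s \<le> j * int s" using mult_right_mono[OF j, of "int s"] 1 by simp
    \<comment> \<open>The second chain costs at least \<open>w - s \<ge> t * s \<ge> p * s\<close>,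
      so it lies below level \<open>p\<close> only if position \<open>p\<close> is already past the
      first chain.\<close>
    have fp: "f < p"
    proof (rule ccontr)
      assume "\<not> f < p"
      then have "int (lev x p) = int p * int s" by (simp add: x f_def)
      then have "int w + j * int s < int p * int s" using lt 1 by (simp only: mult_1)
      then show False using js bd ps by linarith
    qed
    \<comment> \<open>\<open>e\<close> is 1 if the second chain starts at \<open>j = -1\<close> and
      0 if it starts at \<open>j = 0\<close>; thus \<open>j + e\<close> counts its steps from
      0.\<close>
    define e where "e = (if r \<le> y + d then 1 else 0 :: int)"
    have je: "0 \<le> j + e"
    proof (cases "r \<le> y + d")
      case False
      then have "- int r < j * int r" using mj(1) 1 by simp
      then have "0 < (1 + j) * int r" by (simp add: algebra_simps)
      then have "0 < 1 + j" using r_pos by (simp add: zero_less_mult_iff)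
      then show ?thesis by (simp add: e_def)
    qed (use j 1 in \<open>simp add: e_def\<close>)
    define i where "i = nat (j + e)"
    have i: "j = int i - e" using je by (simp add: i_def)
    have "int (lev x p) = int w + int (p - f - 1) * int s - e * int s"
      using fp s_le_w by (auto simp: x f_def[symmetric] e_def of_nat_diff)
    then have "int i * int s < int (p - f - 1) * int s"
      using lt 1 i by (simp add: algebra_simps)
    then have ip: "i < p - f - 1" using s_pos by simp
    have "i * u \<le> t * u" using ip p by (intro mult_le_mono1) simp
    then have "i * u \<le> z + q" unfolding q_def by (metis add.assoc add.commute mult.commute trans_le_add1)
    have "int Y = int (y + d + i * r) - e * int r" "int Z = int (z + q) - int (i * u) + e * int u"
      using mj 1 i by (simp_all add: left_diff_distrib)
    then have "X = pt x (f + 1 + i)" using \<open>i * u \<le> z + q\<close>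
      unfolding x XX pt.simps f_def[symmetric] e_def
      by (cases "r \<le> y + d"; simp del: of_nat_add of_nat_mult; linarith)
    then show ?thesis using ip by auto
  next
    case 2
    \<comment> \<open>Such a pair costs at least \<open>m (w - s) \<ge> 2 w - 2 s\<close>, whereas
      position \<open>p\<close> has level at most \<open>w + p s - s\<close>; by
      \<open>bound\<close> the former is no smaller.\<close>
    have "(- m) * int s \<le> j * int s" using j by (intro mult_right_mono) auto
    moreover have "2 * (int w - int s) \<le> m * (int w - int s)"
      using 2 sw by (intro mult_right_mono) auto
    ultimately have lo: "2 * int w - 2 * int s \<le> m * int w + j * int s"
      by (simp add: algebra_simps)
    have "int (lev x p) \<le> int w + int p * int s - int s"
    proof (cases "p \<le> f")
      case True
      then show ?thesis using sw by (simp add: x f_def[symmetric])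
    next
      case False
      then have "int (p - f - 1) \<le> int p - 1" by simp
      from mult_right_mono[OF this, of "int s"]
      have "int (p - f - 1) * int s \<le> int p * int s - int s" by (simp add: algebra_simps)
      moreover have "lev x p \<le> w + (p - f - 1) * s" using False by (simp add: x f_def)
      then have "int (lev x p) \<le> int w + int (p - f - 1) * int s"
        by (metis of_nat_add of_nat_le_iff of_nat_mult)
      ultimately show ?thesis by linarith
    qed
    with lo lt have "2 * int w - 2 * int s < int w + int p * int s - int s"
      by (metis le_less_trans less_le_trans)
    then show ?thesis using bd ps by linarith
  qed
qed

section \<open>Counting the integers with few pairs\<close>

lemma finite_pts:
  assumes "0 < b" "0 < c"
  shows "finite (pts n)"
proof (rule finite_subset)
  show "pts n \<subseteq> {..n} \<times> {..n}"
  proof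
    fix X assume "X \<in> pts n"
    then obtain Y Z where X: "X = (Y, Z)" "b * Y + c * Z \<le> n" by (cases X) (auto simp: pts_def)
    moreover have "Y \<le> b * Y" "Z \<le> c * Z" using assms by simp_all
    ultimately have "Y \<le> n" "Z \<le> n" by linarith+
    then show "X \<in> {..n} \<times> {..n}" using X by simp
  qed
qed simp

text \<open>Thus the numbers \<open>val x + a * lev x p\<close> form the \<open>p\<close>-Apery set
  of the generators. At or above this number the first \<open>p + 1\<close> points of the chains all
  count; below it at most the first \<open>p\<close> do.\<close>

lemma card_pts_less_iff:
  assumes "0 < b" "0 < c" and p: "p \<le> t" and L: "x \<in> L" and n: "[n = val x] (mod a)"
  shows "p < card (pts n) \<longleftrightarrow> val x + a * lev x p \<le> n"
proof
  assume *: "val x + a * lev x p \<le> n"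
  have "pt x ` {..p} \<subseteq> pts n"
  proof (rule image_subsetI)
    fix j assume "j \<in> {..p}"
    then have "j \<le> p" by simp
    then have "lev x j \<le> lev x p" using lev_less[of j p x] p by (cases "j = p") auto
    then have "a * lev x j \<le> a * lev x p" by (rule mult_le_mono2)
    then have "val (pt x j) \<le> n" using val_pt(1)[of j x] \<open>j \<le> p\<close> p * by linarith
    moreover have "[val (pt x j) = n] (mod a)"
      using val_pt(2)[of j x] \<open>j \<le> p\<close> p n by (metis cong_sym cong_trans le_trans)
    ultimately show "pt x j \<in> pts n" by (simp add: pts_def)
  qed
  then have "card (pt x ` {..p}) \<le> card (pts n)"
    by (rule card_mono[OF finite_pts[OF assms(1,2)]])
  moreover have "card (pt x ` {..p}) = p + 1"
    using inj_on_subset[OF inj_on_pt, of "{..p}" x] p by (simp add: card_image)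
  ultimately show "p < card (pts n)" by simp
next
  assume *: "p < card (pts n)"
  show "val x + a * lev x p \<le> n"
  proof (rule ccontr)
    assume "\<not> val x + a * lev x p \<le> n"
    then have "pts n \<subseteq> pt x ` {..<p}"
      using pts_below[OF p L] n by (auto simp: pts_def dest: cong_trans)
    then have "card (pts n) \<le> card (pt x ` {..<p})" by (rule card_mono[rotated]) simp
    also have "\<dots> \<le> p" using card_image_le[of "{..<p}" "pt x"] by simp
    finally show False using * by simp
  qed
qed

lemma card_residue_below: "card {n. n < M \<and> [n = M] (mod a)} = M div a"
proof -
  have "{n. n < M \<and> [n = M] (mod a)} = (\<lambda>k. k * a + M mod a) ` {..<M div a}"
  proof safe
    fix n assume *: "n < M" "[n = M] (mod a)"
    then have "n = n div a * a + M mod a" by (metis cong_def div_mult_mod_eq)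
    moreover have "n div a < M div a"
    proof (rule ccontr)
      assume "\<not> n div a < M div a"
      then have "M div a * a \<le> n div a * a" by (intro mult_le_mono1) simp
      then have "M div a * a + M mod a \<le> n div a * a + n mod a"
        using * by (simp only: cong_def add_le_mono)
      then show False using * by (simp only: div_mult_mod_eq)
    qed
    ultimately show "n \<in> (\<lambda>k. k * a + M mod a) ` {..<M div a}" by blast
  next
    fix k assume "k < M div a"
    then have "k * a < M div a * a" using a_pos by simp
    then have "k * a + M mod a < M div a * a + M mod a" by (rule add_strict_right_mono)
    then show "k * a + M mod a < M" unfolding div_mult_mod_eq .
  qed (simp add: cong_def)
  moreover have "inj_on (\<lambda>k. k * a + M mod a) {..<M div a}" using a_pos by (auto simp: inj_on_def)
  ultimately show ?thesis by (simp add: card_image)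
qed

text \<open>The gaps split into residue classes indexed by \<open>L\<close>; each class contributes
  its members below its \<open>p\<close>-Apery element.\<close>

lemma card_few_pts:
  assumes "0 < b" "0 < c" and p: "p \<le> t"
  shows "card {n. \<not> p < card (pts n)} = (\<Sum>x\<in>L. (val x + a * lev x p) div a)"
proof -
  let ?M = "\<lambda>x. val x + a * lev x p"
  let ?N = "\<lambda>x. {n. n < ?M x \<and> [n = ?M x] (mod a)}"
  have Mc: "[n = ?M x] (mod a) \<longleftrightarrow> [n = val x] (mod a)" for n x by (simp add: cong_def)
  have "{n. \<not> p < card (pts n)} = (\<Union>x\<in>L. ?N x)"
  proof (intro equalityI subsetI)
    fix n assume n: "n \<in> {n. \<not> p < card (pts n)}"
    have "n mod a \<in> (\<lambda>x. val x mod a) ` L" unfolding image_L using a_pos by simp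
    then obtain x where "x \<in> L" "[n = val x] (mod a)" by (auto simp: cong_def)
    then show "n \<in> (\<Union>x\<in>L. ?N x)"
      using n card_pts_less_iff[OF assms, of x n] Mc by (auto simp: not_le)
  next
    fix n assume "n \<in> (\<Union>x\<in>L. ?N x)"
    then obtain x where x: "x \<in> L" "n < ?M x" "[n = val x] (mod a)" using Mc by blast
    then show "n \<in> {n. \<not> p < card (pts n)}"
      using card_pts_less_iff[OF assms x(1,3)] by simp
  qed
  then have "card {n. \<not> p < card (pts n)} = card (\<Union>x\<in>L. ?N x)" by simp
  also have "\<dots> = (\<Sum>x\<in>L. card (?N x))"
  proof (rule card_UN_disjoint[OF finite_L])
    show "\<forall>i\<in>L. \<forall>j\<in>L. i \<noteq> j \<longrightarrow> ?N i \<inter> ?N j = {}"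
    proof (intro ballI impI)
      fix i j assume *: "i \<in> L" "j \<in> L" "i \<noteq> j"
      then have "val i mod a \<noteq> val j mod a" using inj_on_L by (auto dest: inj_onD)
      then show "?N i \<inter> ?N j = {}" unfolding Mc by (auto simp: cong_def)
    qed
  qed simp
  also have "\<dots> = (\<Sum>x\<in>L. ?M x div a)" by (simp only: card_residue_below)
  finally show ?thesis .
qed

section \<open>Summation over the L-shaped region\<close>

lemma sum_lessThan_int: "2 * (\<Sum>k<n. int k) = int n * (int n - 1)"
  by (induction n) (simp_all add: algebra_simps)

text \<open>This is Selmer's genus formula for the \<open>p\<close>-Apery set:
  \<open>a * (M div a) = M - M mod a\<close>, and by \<open>image_L\<close> the remainders run
  through \<open>0, ..., a - 1\<close>. The factor 2 avoids division.\<close>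

lemma twice_card_few_pts:
  assumes "0 < b" "0 < c" and p: "p \<le> t"
  shows "int a * (2 * int (card {n. \<not> p < card (pts n)}) + int a - 1) =
    2 * (\<Sum>x\<in>L. int (val x)) + 2 * int a * (\<Sum>x\<in>L. int (lev x p))"
proof -
  have "int a * int (card {n. \<not> p < card (pts n)}) + (\<Sum>k<a. int k)
    = (\<Sum>x\<in>L. int (a * ((val x + a * lev x p) div a) + (val x + a * lev x p) mod a))"
  proof -
    have "(\<Sum>k<a. int k) = (\<Sum>x\<in>L. int (val x mod a))"
      unfolding image_L[symmetric] by (subst sum.reindex[OF inj_on_L]) simp
    then show ?thesis unfolding card_few_pts[OF assms]
      by (simp add: sum.distrib sum_distrib_left)
  qed
  also have "\<dots> = (\<Sum>x\<in>L. int (val x)) + int a * (\<Sum>x\<in>L. int (lev x p))"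
    by (simp only: mult_div_mod_eq) (simp add: sum.distrib sum_distrib_left)
  finally show ?thesis using sum_lessThan_int[of a] by (simp add: algebra_simps)
qed

lemma sum_val: "2 * (\<Sum>x\<in>L. int (val x)) =
    int b * (int q * int r * (int r - 1) + int u * int d * (int d - 1))
    + int c * (int r * int q * (int q - 1) + int d * int u * (2 * int q + int u - 1))"
proof -
  have z2: "2 * (\<Sum>z=k..<k + n. int z) = int n * (2 * int k + int n - 1)" for k n
    by (induction n) (simp_all add: algebra_simps)
  have 1: "(\<Sum>x\<in>L. int (val x)) =
      (\<Sum>y<r. \<Sum>z<q. int b * int y + int c * int z)
      + (\<Sum>y<d. \<Sum>z=q..<q + u. int b * int y + int c * int z)"
    unfolding sum_L by simp
  have "2 * (\<Sum>x\<in>L. int (val x)) = int q * int b * (2 * (\<Sum>y<r. int y))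
      + int r * int c * (2 * (\<Sum>z<q. int z))
      + int u * int b * (2 * (\<Sum>y<d. int y)) + int d * int c * (2 * (\<Sum>z=q..<q + u. int z))"
    unfolding 1 by (simp add: sum.distrib sum_distrib_left algebra_simps)
  then show ?thesis unfolding z2 sum_lessThan_int by (simp only: algebra_simps)
qed

text \<open>At position \<open>p\<close> exactly the points with \<open>z < p * u\<close> have left
  the first chain. As \<open>p * u < q\<close>, they fill a strip of the first rectangle; all other
  points have level \<open>p * s\<close>.\<close>

lemma sum_lev:
  assumes p: "p \<le> t"
  shows "2 * (\<Sum>x\<in>L. int (lev x p)) = 2 * int p * int s * (int a - int r * int p * int u)
    + 2 * int r * int p * int u * int w - 2 * int d * int p * int u * int s
    + int s * int r * int u * int p * (int p - 1)"
proof -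
  have pq: "p * u < q" using p by (simp add: q_def mult.commute less_Suc_eq_le)
  have small: "z div u < p \<longleftrightarrow> z < p * u" for z
    using u_pos by (simp add: div_less_iff_less_mult)
  have box2: "lev (y, z) p = p * s" if "q \<le> z" for y z
    using small[of z] that pq by auto
  have box1: "(\<Sum>z<q. int (lev (y, z) p)) = int (q - p * u) * int p * int s
      + (\<Sum>z<p * u. int w + (int p - 1 - int (z div u)) * int s
          - (if r \<le> y + d then int s else 0))" for y
  proof -
    have "(\<Sum>z<q. int (lev (y, z) p)) =
      (\<Sum>z<p * u. int (lev (y, z) p)) + (\<Sum>z=p * u..<q. int (lev (y, z) p))"
      unfolding lessThan_atLeast0 using pq by (simp only: sum.atLeastLessThan_concat)
    moreover have "(\<Sum>z=p * u..<q. int (lev (y, z) p)) = (\<Sum>z=p * u..<q. int p * int s)"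
    proof (rule sum.cong[OF refl])
      fix z assume "z \<in> {p * u..<q}"
      then have "\<not> z div u < p" using small[of z] by simp
      then show "int (lev (y, z) p) = int p * int s" by simp
    qed
    moreover have "(\<Sum>z<p * u. int (lev (y, z) p)) =
      (\<Sum>z<p * u. int w + (int p - 1 - int (z div u)) * int s - (if r \<le> y + d then int s else 0))"
    proof (rule sum.cong[OF refl])
      fix z assume "z \<in> {..<p * u}"
      then have "z div u < p" using small[of z] by simp
      then show "int (lev (y, z) p) =
        int w + (int p - 1 - int (z div u)) * int s - (if r \<le> y + d then int s else 0)"
        using s_le_w by (auto simp: of_nat_diff)
    qed
    ultimately show ?thesis by simp
  qed
  \<comment> \<open>The strip is cut into \<open>p\<close> blocks of height \<open>u\<close>, on
    each of which \<open>z div u\<close> is constant.\<close>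
  have "(\<Sum>z<p * u. int (z div u)) = (\<Sum>m<p. \<Sum>z=m * u..<m * u + u. int (z div u))"
    by (rule sum.nat_group[symmetric])
  also have "\<dots> = (\<Sum>m<p. \<Sum>z=m * u..<m * u + u. int m)"
  proof (intro sum.cong refl)
    fix m z assume "z \<in> {m * u..<m * u + u}"
    then have "z div u = m" by (intro div_nat_eqI) (auto simp: algebra_simps)
    then show "int (z div u) = int m" by simp
  qed
  also have "\<dots> = int u * (\<Sum>m<p. int m)" by (simp add: sum_distrib_left)
  finally have divs: "2 * (\<Sum>z<p * u. int (z div u)) = int u * (int p * (int p - 1))"
    using sum_lessThan_int[of p] by simp
  \<comment> \<open>The restart by \<open>(d - r, q + u)\<close> is available for exactly the
    \<open>d\<close> values \<open>y \<ge> r - d\<close>.\<close>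
  have ind: "(\<Sum>y<r. if r \<le> y + d then int s else 0) = int d * int s"
  proof -
    have "{y. y < r \<and> r \<le> y + d} = {r - d..<r}" using d_less by auto
    then show ?thesis using d_less by (simp add: sum.If_cases Int_def)
  qed
  have "(\<Sum>y<r. \<Sum>z<q. int (lev (y, z) p)) =
      int r * (int (q - p * u) * int p * int s)
      + int r * (int p * int u * int w + int s * ((int p - 1) * int p * int u - (\<Sum>z<p * u. int (z div u))))
      - int p * int u * (int d * int s)"
  proof -
    define D where "D = (\<Sum>z<p * u. int (z div u))"
    define e where "e = (\<lambda>y. if r \<le> y + d then int s else 0)"
    have "(\<Sum>z<p * u. int w + (int p - 1 - int (z div u)) * int s - e y)
        = int (p * u) * int w + (int (p * u) * (int p - 1) - D) * int s - int (p * u) * e y" for y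
      unfolding D_def by (simp only: sum.distrib sum_subtractf sum_distrib_right[symmetric]
          sum_constant card_lessThan right_diff_distrib mult_1_right)
    then have "(\<Sum>y<r. \<Sum>z<q. int (lev (y, z) p)) =
        (\<Sum>y<r. int (q - p * u) * int p * int s + (int (p * u) * int w
          + (int (p * u) * (int p - 1) - D) * int s) - int (p * u) * e y)"
      by (simp only: box1 e_def add_diff_eq)
    also have "\<dots> = int r * (int (q - p * u) * int p * int s + (int (p * u) * int w
          + (int (p * u) * (int p - 1) - D) * int s)) - int (p * u) * (int d * int s)"
      by (simp only: ind e_def sum_subtractf sum_distrib_left[symmetric] sum_constant card_lessThan)
    finally show ?thesis unfolding D_def[symmetric] of_nat_mult by algebra
  qed
  moreover have "(\<Sum>y<d. \<Sum>z=q..<q + u. int (lev (y, z) p)) = int d * (int u * (int p * int s))"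
  proof -
    have "(\<Sum>y<d. \<Sum>z=q..<q + u. int (lev (y, z) p)) = (\<Sum>y<d. \<Sum>z=q..<q + u. int p * int s)"
      by (intro sum.cong refl) (subst box2, auto)
    then show ?thesis by simp
  qed
  ultimately have "2 * (\<Sum>x\<in>L. int (lev x p)) =
      2 * int r * (int (q - p * u) * int p * int s)
      + int r * (2 * int p * int u * int w + int s * (2 * (int p - 1) * int p * int u - 2 * (\<Sum>z<p * u. int (z div u))))
      - 2 * int p * int u * (int d * int s) + 2 * int d * (int u * (int p * int s))"
    unfolding sum_L by algebra
  also have "int (q - p * u) = int q - int p * int u" using pq by (simp add: of_nat_diff)
  finally have *: "2 * (\<Sum>x\<in>L. int (lev x p)) =
      2 * int r * ((int q - int p * int u) * int p * int s)
      + int r * (2 * int p * int u * int w + int s * (2 * (int p - 1) * int p * int u - int u * (int p * (int p - 1))))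
      - 2 * int p * int u * (int d * int s) + 2 * int d * (int u * (int p * int s))"
    unfolding divs .
  show ?thesis using * a_int by algebra
qed

lemma card_few_pts_formula:
  assumes "0 < b" "0 < c" and p: "p \<le> t"
  shows "real (card {n. \<not> p < card (pts n)}) =
    - (real p ^ 2 / 2) * real u * real r * real s
    + real p / 2 * real r * (2 * real b - real u * real s)
    + 1 / (2 * real u) * ((real a - real u) * (real b - real u)
         + real u * (real u - 1) * (real c - 1)
         - real q * real s * (2 * real a - (real q + real u) * real r))"
proof -
  define g where "g = card {n. \<not> p < card (pts n)}"
  define Q where "Q = q"
  have "int a * (2 * int g + int a - 1) =
     (int b * (int q * int r * (int r - 1) + int u * int d * (int d - 1))
    + int c * (int r * int q * (int q - 1) + int d * int u * (2 * int q + int u - 1)))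
    + int a * (2 * int p * int s * (int a - int r * int p * int u)
    + 2 * int r * int p * int u * int w - 2 * int d * int p * int u * int s
    + int s * int r * int u * int p * (int p - 1))"
    using twice_card_few_pts[OF assms] sum_val sum_lev[OF p] unfolding g_def by algebra
  from arg_cong[OF this, of real_of_int] have
    main: "real a * (2 * real g + real a - 1) =
     (real b * (real Q * real r * (real r - 1) + real u * real d * (real d - 1))
    + real c * (real r * real Q * (real Q - 1) + real d * real u * (2 * real Q + real u - 1)))
    + real a * (2 * real p * real s * (real a - real r * real p * real u)
    + 2 * real r * real p * real u * real w - 2 * real d * real p * real u * real s
    + real s * real r * real u * real p * (real p - 1))"
    unfolding Q_def[symmetric] by simp
  have 1: "real r * real b = real u * real c + real s * real a"
    using rel by (metis of_nat_add of_nat_mult)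
  have 2: "real a = real u * real d + real r * real Q"
    using a_eq unfolding Q_def q_def by (metis of_nat_add of_nat_mult)
  have 3: "real b = real u * real w + real Q * real s"
    using b_eq unfolding Q_def q_def by (metis of_nat_add of_nat_mult)
  \<comment> \<open>Multiplying by \<open>a\<close> and \<open>u\<close> leaves a polynomial
    identity, which follows from \<open>main\<close> modulo the three relations; then
    \<open>a\<close> is cancelled.\<close>
  have "real a * (real u * (2 * real g)) = real a * (
      - (real p ^ 2) * real u^2 * real r * real s
    + real u * real p * real r * (2 * real b - real u * real s)
    + ((real a - real u) * (real b - real u)
         + real u * (real u - 1) * (real c - 1)
         - real Q * real s * (2 * real a - (real Q + real u) * real r)))"
    using main 1 2 3 by algebra
  then have "real u * (2 * real g) = 
      - (real p ^ 2) * real u^2 * real r * real s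
    + real u * real p * real r * (2 * real b - real u * real s)
    + ((real a - real u) * (real b - real u)
         + real u * (real u - 1) * (real c - 1)
         - real Q * real s * (2 * real a - (real Q + real u) * real r))"
    using a_pos by simp
  then show ?thesis using u_pos unfolding g_def[symmetric] Q_def[symmetric]
    by (simp add: field_simps power2_eq_square)
qed

section \<open>From pairs to representations by three generators\<close>

lemma card_representations:
  assumes "a < b" "b < c"
  shows "card (representations {a, b, c} n) = card (pts n)"
proof -
  \<comment> \<open>The coefficient of \<open>a\<close> is recovered from the other two. The strict
    order keeps the three function updates apart, and \<open>undefined\<close> is the value of an
    extensional function off its domain.\<close>
  have "bij_betw (\<lambda>x. (x b, x c)) (representations {a, b, c} n) (pts n)"
  proof (rule bij_betw_byWitness[where f' = "\<lambda>(y, z).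
      (\<lambda>v. undefined)(a := (n - (b * y + c * z)) div a, b := y, c := z)"])
    show "\<forall>x\<in>representations {a, b, c} n.
        (\<lambda>(y, z). (\<lambda>v. undefined)(a := (n - (b * y + c * z)) div a, b := y, c := z)) (x b, x c) = x"
      using assms a_pos by (auto simp: representations_def PiE_def extensional_def fun_eq_iff algebra_simps)
    show "\<forall>x\<in>pts n. (\<lambda>x. (x b, x c)) ((\<lambda>(y, z).
        (\<lambda>v. undefined)(a := (n - (b * y + c * z)) div a, b := y, c := z)) x) = x"
      using assms by auto
    show "(\<lambda>x. (x b, x c)) ` representations {a, b, c} n \<subseteq> pts n"
      using assms by (auto simp: representations_def pts_def cong_def algebra_simps)
    show "(\<lambda>(y, z). (\<lambda>v. undefined)(a := (n - (b * y + c * z)) div a, b := y, c := z)) ` pts n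
        \<subseteq> representations {a, b, c} n"
    proof clarify
      fix y z assume "(y, z) \<in> pts n"
      then have "b * y + c * z \<le> n" "a dvd n - (b * y + c * z)"
        by (auto simp: pts_def cong_sym_eq cong_altdef_nat)
      then show "(\<lambda>v. undefined)(a := (n - (b * y + c * z)) div a, b := y, c := z)
          \<in> representations {a, b, c} n"
        using assms by (auto simp: representations_def PiE_def extensional_def algebra_simps)
    qed
  qed
  then show ?thesis by (rule bij_betw_same_card)
qed

end

section \<open>Pell-type numbers\<close>

lemma pell_pos: "0 < u \<Longrightarrow> 0 < n \<Longrightarrow> 0 < pell u n"
  by (induction u n rule: pell.induct) auto

lemma pell_mono_Suc: "0 < u \<Longrightarrow> pell u n \<le> pell u (Suc n)"
  by (cases n) (auto simp: trans_le_add1)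

lemma pell_mono: "0 < u \<Longrightarrow> m \<le> n \<Longrightarrow> pell u m \<le> pell u n"
  by (rule lift_Suc_mono_le[of "pell u"]) (auto simp: pell_mono_Suc)

text \<open>Strict growth is claimed from index 2 on only, since \<open>P_1 = P_2 = 1\<close> for
  \<open>u = 1\<close>.\<close>

lemma pell_less_Suc_Suc:
  assumes "0 < u"
  shows "pell u (Suc (Suc n)) < pell u (Suc (Suc (Suc n)))"
proof -
  have "pell u (Suc (Suc n)) \<le> u * pell u (Suc (Suc n))" using assms by simp
  then show ?thesis using pell_pos[OF assms, of "Suc n"] pell.simps(3)[of u "Suc n"] by linarith
qed

lemma pell_less: "0 < u \<Longrightarrow> 2 \<le> m \<Longrightarrow> m < n \<Longrightarrow> pell u m < pell u n"
proof (induction n)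
  case (Suc n)
  then obtain n' where "n = 2 + n'" using le_Suc_ex[of 2 n] by auto
  then have "pell u n < pell u (Suc n)"
    using pell_less_Suc_Suc[of u n'] Suc by (simp del: pell.simps)
  moreover have "pell u m \<le> pell u n" using Suc pell_mono by simp
  ultimately show ?case by linarith
qed simp

text \<open>Modulo \<open>u\<close> the recurrence reads \<open>P_{n+2} = P_n\<close>.\<close>

lemma pell_cong_one: "odd n \<Longrightarrow> [pell u n = 1] (mod u)"
proof (induction u n rule: pell.induct)
  case (3 u n)
  then have "[pell u n = 1] (mod u)" by simp
  then show ?case by (simp add: cong_def)
qed auto

lemma coprime_pell_Suc: "coprime (pell u n) (pell u (Suc n))"
proof (induction n)
  case (Suc n)
  have "gcd (pell u (Suc n)) (u * pell u (Suc n) + pell u n) = gcd (pell u (Suc n)) (pell u n)"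
    by (rule gcd_add_mult)
  then show ?case using Suc by (simp only: pell.simps coprime_iff_gcd_eq_1 gcd.commute)
qed simp

lemma coprime_pell_base: "odd n \<Longrightarrow> coprime (pell u n) u"
  using pell_cong_one[of n u] by (metis cong_imp_coprime cong_sym coprime_1_left)

lemma coprime_pell_Suc_Suc:
  assumes "odd n"
  shows "coprime (pell u n) (pell u (Suc (Suc n)))"
proof -
  have "coprime (pell u n) (u * pell u (Suc n))"
    using coprime_pell_base[OF assms] coprime_pell_Suc by simp
  moreover have "gcd (pell u n) (u * pell u (Suc n) + pell u n) = gcd (pell u n) (u * pell u (Suc n))"
    using gcd_add_mult[of "pell u n" 1 "u * pell u (Suc n)"] by (simp only: mult_1 add.commute)
  ultimately show ?thesis by (simp only: pell.simps coprime_iff_gcd_eq_1)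
qed

text \<open>Both sides satisfy the Pell recurrence in \<open>k\<close>. At \<open>k - 2\<close> and
  \<open>n = 2 i + 1\<close> this is the relation \<open>rel\<close> of the locale.\<close>

lemma pell_add: "pell u (k + 2) * pell u (n + 2) = u * pell u (n + k + 2) + pell u k * pell u n"
proof (induction u k rule: pell.induct)
  case (3 u k)
  have "pell u (Suc (Suc k) + 2) * pell u (n + 2)
      = u * (pell u (Suc k + 2) * pell u (n + 2)) + pell u (k + 2) * pell u (n + 2)"
    by (simp add: algebra_simps)
  also have "\<dots> = u * (u * pell u (n + Suc k + 2) + pell u (n + k + 2))
      + (u * pell u (Suc k) + pell u k) * pell u n"
    unfolding 3 by (simp only: algebra_simps)
  finally show ?case by simp
qed (simp_all add: algebra_simps)

lemma pell_growth: "(u\<^sup>2 + 1) * pell u n \<le> pell u (n + 2)"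
proof (cases n)
  case (Suc m)
  have "u * pell u n \<le> pell u (Suc n)" by (simp add: Suc)
  then have "u * (u * pell u n) \<le> u * pell u (Suc n)" by (rule mult_le_mono2)
  then show ?thesis by (simp add: power2_eq_square algebra_simps)
qed simp

section \<open>The genus\<close>

theorem theorem5:
  fixes u i k p :: nat and q :: int
  assumes "u > 0" and "i \<ge> 2" and "odd k" and "3 \<le> k" and "k \<le> 2 * i - 1"
    and "q = (GREATEST r :: int.
      real_of_int r \<le> real (pell u (2 * i + 1)) / real (pell u k) \<and> [r = 1] (mod int u))"
    and "real p \<le> (real_of_int q - 1) / real u"
  shows "real (p_genus p {pell u (2 * i + 1), pell u (2 * i + 3), pell u (2 * i + k + 1)}) =
    - (real p ^ 2 / 2) * real u * real (pell u k) * real (pell u (k - 2))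
    + real p / 2 * real (pell u k) *
        (2 * real (pell u (2 * i + 3)) - real u * real (pell u (k - 2)))
    + 1 / (2 * real u) *
        ((real (pell u (2 * i + 1)) - real u) * (real (pell u (2 * i + 3)) - real u)
         + real u * (real u - 1) * (real (pell u (2 * i + k + 1)) - 1)
         - real_of_int q * real (pell u (k - 2)) *
             (2 * real (pell u (2 * i + 1)) - (real_of_int q + real u) * real (pell u k)))"
proof -
  define a b c r s where "a = pell u (2 * i + 1)" and "b = pell u (2 * i + 3)"
    and "c = pell u (2 * i + k + 1)" and "r = pell u k" and "s = pell u (k - 2)"
  note defs = a_def b_def c_def r_def s_def
  \<comment> \<open>With this \<open>t\<close>, \<open>Q\<close> is the largest integer congruent to
    1 modulo \<open>u\<close> that is at most \<open>a / r\<close>, and the hypothesis on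
    \<open>p\<close> becomes \<open>p \<le> t\<close>.\<close>
  define t where "t = (a div r - 1) div u"
  define Q where "Q = 1 + u * t"
  have r_pos: "0 < r" and s_pos: "0 < s" using assms(1,4) by (auto simp: defs intro!: pell_pos)
  have ra: "r \<le> a" unfolding defs using assms by (intro pell_mono) auto
  have A1: "1 \<le> a div r" using ra r_pos by (simp add: Suc_le_eq div_greater_zero_iff)
  have QA: "Q \<le> a div r"
  proof -
    have "u * t \<le> a div r - 1" unfolding t_def by simp
    then show ?thesis using A1 by (simp add: Q_def)
  qed
  have AQ: "a div r < Q + u"
  proof -
    have "a div r - 1 < u * (t + 1)" unfolding t_def using assms(1)
      by (metis Suc_eq_plus1 dividend_less_times_div mult.commute mult_Suc)
    then show ?thesis by (simp add: Q_def)
  qed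
  have rQ: "r * Q \<le> a" using QA r_pos by (simp add: less_eq_div_iff_mult_less_eq mult.commute)
  have rQu: "a < r * (Q + u)" using AQ r_pos by (simp add: div_less_iff_less_mult mult.commute)
  have q: "q = int Q"
    unfolding assms(6)
  proof (rule Greatest_equality)
    have "real Q \<le> real a / real r"
      using rQ r_pos by (simp add: pos_le_divide_eq mult.commute flip: of_nat_mult)
    then show "real_of_int (int Q) \<le> real (pell u (2 * i + 1)) / real (pell u k) \<and> [int Q = 1] (mod int u)"
      by (simp add: defs Q_def cong_def)
  next
    fix y assume y: "real_of_int y \<le> real (pell u (2 * i + 1)) / real (pell u k) \<and> [y = 1] (mod int u)"
    then have "real_of_int y * real r \<le> real a" using r_pos by (simp add: defs pos_le_divide_eq)
    then have "y * int r \<le> int a" by (metis of_int_le_iff of_int_mult of_int_of_nat_eq)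
    also have "int a < int (Q + u) * int r" using rQu
      by (metis mult.commute of_nat_less_iff of_nat_mult)
    finally have "y < int Q + int u" using r_pos by simp
    \<comment> \<open>A larger \<open>y\<close> in this class would be at least
      \<open>Q + u\<close>, hence beyond \<open>a / r\<close>.\<close>
    moreover have "[y = int Q] (mod int u)" using y by (simp add: Q_def cong_def)
    then have "int u dvd y - int Q" by (simp add: cong_iff_dvd_diff)
    ultimately show "y \<le> int Q" using zdvd_imp_le[of "int u" "y - int Q"] by linarith
  qed
  have p: "p \<le> t"
  proof -
    have "real p * real u \<le> real u * real t"
      using assms(1,7) by (simp add: q Q_def pos_le_divide_eq)
    then have "real p \<le> real t" using assms(1) by (simp add: mult.commute)
    then show ?thesis by simp
  qed
  have a1: "[a = 1] (mod u)" and b1: "[b = 1] (mod u)" and r1: "[r = 1] (mod u)"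
    and s1: "[s = 1] (mod u)"
    unfolding defs using assms(3,4) by (intro pell_cong_one; simp)+
  have Q1: "[Q = 1] (mod u)" unfolding Q_def cong_def by (metis mod_mult_self2)
  have grow_r: "(u\<^sup>2 + 1) * s \<le> r"
    unfolding defs using pell_growth[of u "k - 2"] assms(4) by (simp only: le_add_diff_inverse2)
  have grow_b: "(u\<^sup>2 + 1) * a \<le> b"
    unfolding defs using pell_growth[of u "2 * i + 1"] by (simp add: numeral_3_eq_3 del: pell.simps)
  \<comment> \<open>Since \<open>u (t + 1) = Q + u - 1\<close> and \<open>u w = b - Q s\<close>,
    this is \<open>bound\<close> multiplied by \<open>u\<close>. The growth from \<open>s\<close> to
    \<open>r\<close> and from \<open>a\<close> to \<open>b\<close> gives
    \<open>(u^2 + 1)^2 Q s \<le> b\<close>.\<close>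
  have big: "(2 * Q + u) * s \<le> b + s"
  proof -
    have "(u\<^sup>2 + 1) * ((u\<^sup>2 + 1) * s * Q) \<le> (u\<^sup>2 + 1) * (r * Q)"
      using grow_r by (intro mult_le_mono2 mult_le_mono1)
    also have "\<dots> \<le> (u\<^sup>2 + 1) * a" using rQ by (intro mult_le_mono2)
    finally have 1: "((u\<^sup>2 + 1) * (u\<^sup>2 + 1) * Q) * s \<le> b" using grow_b by (simp add: algebra_simps)
    \<comment> \<open>With \<open>Q = 1 + u t\<close>, constant terms and multiples of
      \<open>u t\<close> are compared separately.\<close>
    have "u \<le> u\<^sup>2" by (simp add: power2_eq_square)
    then have "2 + u \<le> (u\<^sup>2 + 1) * (u\<^sup>2 + 1) + 1" by (simp add: algebra_simps)
    moreover have "2 * (u * t) \<le> (u\<^sup>2 + 1) * (u\<^sup>2 + 1) * (u * t)"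
      using mult_le_mono[of 2 "u\<^sup>2 + 1" 1 "u\<^sup>2 + 1"] assms(1) by (intro mult_le_mono1) simp
    ultimately have "2 * Q + u \<le> (u\<^sup>2 + 1) * (u\<^sup>2 + 1) * Q + 1"
      unfolding Q_def by (simp only: distrib_left mult_1_right)
    from mult_le_mono1[OF this, of s] show ?thesis using 1 by (simp add: distrib_right)
  qed
  have Qs: "Q * s \<le> b"
  proof -
    have "1 * s \<le> (Q + u) * s" by (intro mult_le_mono1) (simp add: Q_def)
    then show ?thesis using big by (simp add: algebra_simps)
  qed
  \<comment> \<open>\<open>a\<close>, \<open>b\<close>, \<open>r\<close>, \<open>s\<close> have odd
    index and \<open>Q\<close> is 1 modulo \<open>u\<close>, so \<open>u\<close> divides
    \<open>a - r Q\<close> and \<open>b - Q s\<close>; the quotients are \<open>d\<close> and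
    \<open>w\<close>.\<close>
  have "[r * Q = a] (mod u)" using cong_mult[OF r1 Q1] a1 by (metis cong_sym cong_trans mult_1)
  then have "u dvd a - r * Q" using rQ by (simp add: cong_altdef_nat cong_sym_eq)
  then obtain d where "a - r * Q = u * d" by (elim dvdE)
  then have d: "a = u * d + r * Q" using rQ by simp
  have "[Q * s = b] (mod u)" using cong_mult[OF Q1 s1] b1 by (metis cong_sym cong_trans mult_1)
  then have "u dvd b - Q * s" using Qs by (simp add: cong_altdef_nat cong_sym_eq)
  then obtain w where "b - Q * s = u * w" by (elim dvdE)
  then have w: "b = u * w + Q * s" using Qs by simp
  have d_less: "d < r"
  proof -
    \<comment> \<open>Maximality of \<open>Q\<close>, in the form \<open>a < r (Q + u)\<close>,
      bounds \<open>d\<close>.\<close>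
    have "u * d < u * r" using rQu d by (simp add: algebra_simps)
    then show ?thesis by simp
  qed
  have bound: "(t + 1) * s \<le> w"
  proof -
    have "u * ((t + 1) * s) \<le> u * w" using big unfolding w by (simp add: Q_def algebra_simps)
    then show ?thesis using assms(1) by simp
  qed
  have rel: "r * b = u * c + s * a"
  proof -
    have "k - 2 + 2 = k" "2 * i + 1 + 2 = 2 * i + 3" "2 * i + 1 + (k - 2) + 2 = 2 * i + k + 1"
      using assms(4) by simp_all
    then show ?thesis using pell_add[of u "k - 2" "2 * i + 1"] by (simp only: defs)
  qed
  interpret two_generator_lattice a b c r s u t d w
  proof
    show "coprime a b" unfolding defs using coprime_pell_Suc_Suc[of "2 * i + 1" u]
      by (simp add: numeral_3_eq_3 del: pell.simps)
    show "coprime a u" unfolding defs by (rule coprime_pell_base) simp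
  qed (use d w d_less bound rel assms(1) s_pos Q_def in auto)
  have ab: "a < b" and bc: "b < c" unfolding defs using assms by (auto intro!: pell_less)
  have "p_genus p {a, b, c} = card {n. \<not> p < card (pts n)}"
    unfolding p_genus_def S_set_def card_representations[OF ab bc] by (rule arg_cong[of _ _ card]) auto
  moreover have "two_generator_lattice.q u t = Q" by (simp only: q_def Q_def)
  ultimately show ?thesis
    using card_few_pts_formula[of p] p ab bc unfolding q defs[symmetric] by simp
qed

end
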